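(* Let $G=(V,E,w)$ be a finite vertex-weighted graph with nonnegative vertex weights $\{w_v\}_{v\in V}$ and maximum degree $\Delta$. For any integer $k\ge \Delta+1$, there exists a $2$-EQ1 $k$-coloring of $G$.
   Context: For $S\subseteq V$, $w(S)=\sum_{v\in S}w_v$. A $k$-coloring of $G$ is a partition $(C_1,\dots,C_k)$ of $V$ into $k$ (possibly empty) sets, each of which is an independent set of $G$. For $\alpha\ge 1$, a coloring $(C_1,\dots,C_k)$ is $\alpha$-EQ1 ($\alpha$-approximately equitable up to one vertex) if for every $i,j\in[k]$ with $C_i\neq\emptyset$ there exists a vertex $\bar v\in C_i$ such that $w(C_i\setminus\{\bar v\})\le \alpha\, w(C_j)$. *)

theory Defs
  imports Complex_Main "HOL-Library.Disjoint_Sets"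
begin

definition finite_simple_graph :: "'a set \<Rightarrow> 'a set set \<Rightarrow> bool" where
  "finite_simple_graph V E \<longleftrightarrow> finite V \<and> (\<forall>e\<in>E. e \<subseteq> V \<and> card e = 2)"

definition vertex_degree :: "'a set set \<Rightarrow> 'a \<Rightarrow> nat" where
  "vertex_degree E v = card {e \<in> E. v \<in> e}"

(* Inserting 0 only matters for the graph without vertices, whose maximum degree is taken to be 0. *)
definition max_degree :: "'a set \<Rightarrow> 'a set set \<Rightarrow> nat" where
  "max_degree V E = Max (insert 0 (vertex_degree E ` V))"

definition independent_set :: "'a set \<Rightarrow> 'a set set \<Rightarrow> 'a set \<Rightarrow> bool" where
  "independent_set V E S \<longleftrightarrow> S \<subseteq> V \<and> (\<forall>u\<in>S. \<forall>v\<in>S. {u, v} \<notin> E)"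

(* The classes are C 1, ..., C k and may be empty, so partition_on does not apply. *)
definition is_coloring :: "'a set \<Rightarrow> 'a set set \<Rightarrow> nat \<Rightarrow> (nat \<Rightarrow> 'a set) \<Rightarrow> bool" where
  "is_coloring V E k C \<longleftrightarrow>
     (\<Union>i\<in>{1..k}. C i) = V \<and> disjoint_family_on C {1..k} \<and>
     (\<forall>i\<in>{1..k}. independent_set V E (C i))"

definition EQ1 :: "real \<Rightarrow> ('a \<Rightarrow> real) \<Rightarrow> nat \<Rightarrow> (nat \<Rightarrow> 'a set) \<Rightarrow> bool" where
  "EQ1 \<alpha> w k C \<longleftrightarrow>
     (\<forall>i\<in>{1..k}. \<forall>j\<in>{1..k}. C i \<noteq> {} \<longrightarrow>
        (\<exists>v\<in>C i. sum w (C i - {v}) \<le> \<alpha> * sum w (C j)))"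

end

theory Submission
  imports Defs
begin

text \<open>
  Among all proper colorings choose one whose lightest class has maximal weight \<open>m\<close> and, subject to
  this, with the fewest classes of weight \<open>m\<close>. If a class \<open>A\<close> violates the EQ1 condition, then
  \<open>w (A - {v}) > 2 m\<close> for all \<open>v \<in> A\<close>, so cutting off an inclusion-minimal part of weight greater
  than \<open>m\<close> splits \<open>A\<close> into two parts that both weigh more than \<open>m\<close>. Dissolve a class of weight \<open>m\<close>,
  let the two parts of \<open>A\<close> be classes of their own, and put the vertices of the dissolved class back
  greedily, which is possible since every vertex has fewer than \<open>k\<close> neighbours. No other class loses
  weight, so this contradicts the choice of the coloring.
\<close>

text \<open>Colorings are functions judged only on \<open>U\<close>, so that a partial coloring can
  be extended one vertex at a time; values outside \<open>U\<close> are arbitrary.\<close>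

definition proper_on :: "'a set set \<Rightarrow> nat \<Rightarrow> 'a set \<Rightarrow> ('a \<Rightarrow> nat) \<Rightarrow> bool" where
  "proper_on E k U c \<longleftrightarrow>
     c ` U \<subseteq> {1..k} \<and> (\<forall>u\<in>U. \<forall>v\<in>U. {u, v} \<in> E \<longrightarrow> c u \<noteq> c v)"

definition color_class :: "'a set \<Rightarrow> ('a \<Rightarrow> nat) \<Rightarrow> nat \<Rightarrow> 'a set" where
  "color_class V c l = {v \<in> V. c v = l}"

lemma is_coloring_color_class:
  assumes "proper_on E k V c"
  shows "is_coloring V E k (color_class V c)"
  using assms
  unfolding is_coloring_def proper_on_def color_class_def independent_set_def disjoint_family_on_def
  by blast

lemma card_neighbours_le_max_degree:
  assumes "finite_simple_graph V E" "v \<in> V"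
  shows "finite {u. {u, v} \<in> E}" "card {u. {u, v} \<in> E} \<le> max_degree V E"
proof -
  have fV: "finite V" and E: "\<And>e. e \<in> E \<Longrightarrow> e \<subseteq> V"
    using assms(1) by (auto simp: finite_simple_graph_def)
  have fE: "finite E"
    by (rule finite_subset[of _ "Pow V"]) (use fV E in auto)
  show "finite {u. {u, v} \<in> E}"
    by (rule finite_subset[OF _ fV]) (use E in blast)
  have "card {u. {u, v} \<in> E} \<le> card {e \<in> E. v \<in> e}"
    by (rule card_inj_on_le[where f = "\<lambda>u. {u, v}"])
       (auto simp: inj_on_def doubleton_eq_iff fE)
  also have "\<dots> \<le> max_degree V E"
    unfolding max_degree_def vertex_degree_def[symmetric]
    by (rule Max_ge) (use fV assms(2) in auto)
  finally show "card {u. {u, v} \<in> E} \<le> max_degree V E" .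
qed

lemma proper_on_insert:
  assumes "finite_simple_graph V E" "max_degree V E + 1 \<le> k" "v \<in> V" "v \<notin> U"
    and "proper_on E k U c"
  shows "\<exists>a. proper_on E k (insert v U) (c(v := a))"
proof -
  let ?N = "{u. {u, v} \<in> E}"
  note N = card_neighbours_le_max_degree[OF assms(1,3)]
  \<comment> \<open>\<open>?N\<close> also contains neighbours outside \<open>U\<close>. Avoiding
    their arbitrary values as well is affordable, since the degree bound counts all
    neighbours.\<close>
  have "card (c ` ?N) \<le> card ?N"
    by (rule card_image_le[OF N(1)])
  with N(2) assms(2) have "card (c ` ?N) < card {1..k}" by simp
  then obtain a where a: "a \<in> {1..k}" "a \<notin> c ` ?N"
    by (metis N(1) card_mono finite_imageI linorder_not_le subsetI)
  have "{v} \<notin> E"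
    using assms(1) by (auto simp: finite_simple_graph_def)
  with a assms(4,5) have "proper_on E k (insert v U) (c(v := a))"
    unfolding proper_on_def by (auto simp: insert_commute)
  then show ?thesis ..
qed

lemma proper_on_extend:
  assumes "finite_simple_graph V E" "max_degree V E + 1 \<le> k" "U \<subseteq> V" "proper_on E k U c"
  shows "\<exists>c'. proper_on E k V c' \<and> (\<forall>u\<in>U. c' u = c u)"
proof -
  have "\<exists>c'. proper_on E k (U \<union> D) c' \<and> (\<forall>u\<in>U. c' u = c u)"
    if "finite D" "D \<subseteq> V - U" for D
    using that
  proof (induction D rule: finite_induct)
    case empty
    then show ?case using assms(4) by auto
  next
    case (insert v D)
    then obtain c' where c': "proper_on E k (U \<union> D) c'" "\<forall>u\<in>U. c' u = c u" by auto
    obtain a where "proper_on E k (insert v (U \<union> D)) (c'(v := a))"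
      using proper_on_insert[OF assms(1,2) _ _ c'(1), of v] insert by auto
    moreover have "\<forall>u\<in>U. (c'(v := a)) u = c u" using c'(2) insert.prems by auto
    ultimately show ?case by (metis Un_insert_right)
  qed
  from this[of "V - U"] assms(1,3) show ?thesis
    by (auto simp: finite_simple_graph_def Un_absorb1)
qed

lemma split_heavy_set:
  fixes w :: "'a \<Rightarrow> real"
  assumes "finite A" "0 \<le> m" "m < sum w A"
    and heavy: "\<And>v. v \<in> A \<Longrightarrow> 2 * m < sum w (A - {v})"
  shows "\<exists>S\<subseteq>A. m < sum w S \<and> m < sum w (A - S)"
proof -
  obtain S where S: "S \<subseteq> A" "m < sum w S"
    and min: "\<And>T. T \<subseteq> A \<Longrightarrow> m < sum w T \<Longrightarrow> card S \<le> card T"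
    using assms(3) ex_has_least_nat[of "\<lambda>S. S \<subseteq> A \<and> m < sum w S" A card] by auto
  have fS: "finite S" using S(1) assms(1) finite_subset by blast
  obtain x where x: "x \<in> S" using S(2) assms(2) by fastforce
  have "sum w (S - {x}) \<le> m"
    using min[of "S - {x}"] x fS S(1) card_Diff1_less[of S x] by force
  \<comment> \<open>Removing the same \<open>x\<close> from \<open>A\<close> and from
    \<open>S\<close> cancels its weight, so a single heavy vertex does no harm: the rest weighs more
    than \<open>2 * m - m\<close>.\<close>
  moreover have "sum w (A - S) = sum w (A - {x}) - sum w (S - {x})"
  proof -
    have "A - S = (A - {x}) - (S - {x})" using x by auto
    then show ?thesis
      using sum_diff[of "A - {x}" "S - {x}" w] assms(1) S(1) by auto
  qed
  moreover have "2 * m < sum w (A - {x})" using heavy x S(1) by auto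
  ultimately show ?thesis using S by (intro exI[of _ S]) auto
qed

text \<open>The last disjunct is there for color \<open>i\<close>: its class may lose weight, but it
  stays heavier than class \<open>j\<close> was.\<close>

lemma improve_coloring:
  fixes w :: "'a \<Rightarrow> real"
  defines "W \<equiv> \<lambda>V c l. sum w (color_class V c l)"
  assumes G: "finite_simple_graph V E" and k: "max_degree V E + 1 \<le> k"
    and w: "\<And>v. v \<in> V \<Longrightarrow> 0 \<le> w v"
    and c: "proper_on E k V c" and ij: "i \<in> {1..k}" "j \<in> {1..k}"
    and ne: "color_class V c i \<noteq> {}"
    and heavy: "\<And>v. v \<in> color_class V c i \<Longrightarrow> 2 * W V c j < sum w (color_class V c i - {v})"
  shows "\<exists>c'. proper_on E k V c' \<and> W V c j < W V c' j \<and>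
           (\<forall>l\<in>{1..k}. W V c l \<le> W V c' l \<or> W V c j < W V c' l)"
proof -
  let ?A = "color_class V c"
  have fV: "finite V" using G by (simp add: finite_simple_graph_def)
  have fin: "finite (color_class V f l)" for f l using fV by (simp add: color_class_def)
  have mono: "sum w S \<le> sum w T" if "S \<subseteq> T" "T \<subseteq> V" for S T
    by (rule sum_mono2) (use that fV w finite_subset in auto)
  have sub: "color_class V f l \<subseteq> V" for f l by (auto simp: color_class_def)
  have m0: "0 \<le> W V c j" unfolding W_def by (rule sum_nonneg) (use w sub in blast)
  obtain v where v: "v \<in> ?A i" using ne by blast
  have i_gt: "2 * W V c j < W V c i"
    using heavy[OF v] mono[of "?A i - {v}" "?A i"] sub[of c i] by (auto simp: W_def)
  then have "i \<noteq> j" using m0 by auto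
  obtain S where S: "S \<subseteq> ?A i" "W V c j < sum w S" "W V c j < sum w (?A i - S)"
    using split_heavy_set[OF fin m0 _ heavy] i_gt m0 by (auto simp: W_def)
  \<comment> \<open>Color \<open>j\<close> becomes free once its old class is uncolored, so
    \<open>S\<close> takes it over while the rest of class \<open>i\<close> keeps color
    \<open>i\<close>.\<close>
  define c1 where "c1 = (\<lambda>v. if v \<in> S then j else c v)"
  have "c v = i" if "v \<in> S" for v using S(1) that by (auto simp: color_class_def)
  moreover from this have "{u, v} \<notin> E" if "u \<in> S" "v \<in> S" for u v
    using c S(1) sub[of c i] that unfolding proper_on_def by (metis subsetD)
  ultimately have "proper_on E k (V - ?A j) c1"
    using c ij(2) unfolding proper_on_def c1_def color_class_def by auto
  then obtain c' where c': "proper_on E k V c'" "\<And>u. u \<in> V - ?A j \<Longrightarrow> c' u = c1 u"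
    using proper_on_extend[OF G k] by (metis Diff_subset)
  \<comment> \<open>Greedy reinsertion only adds vertices to classes, and weights are nonnegative,
    so lower bounds on weights survive.\<close>
  have j: "S \<subseteq> color_class V c' j" and i: "?A i - S \<subseteq> color_class V c' i"
    using S(1) c'(2) \<open>i \<noteq> j\<close> by (auto simp: color_class_def c1_def)
  have l: "?A l \<subseteq> color_class V c' l" if "l \<noteq> i" "l \<noteq> j" for l
    using S(1) c'(2) that by (auto simp: color_class_def c1_def)
  have "W V c j < W V c' j" "W V c j < W V c' i"
    using S(2,3) mono[OF j sub] mono[OF i sub] by (auto simp: W_def)
  moreover have "W V c l \<le> W V c' l" if "l \<noteq> i" "l \<noteq> j" for l
    using mono[OF l[OF that] sub] by (simp add: W_def)
  ultimately show ?thesis using c'(1) by metis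
qed

theorem theorem1:
  fixes V :: "'a set" and E :: "'a set set" and w :: "'a \<Rightarrow> real" and k :: nat
  assumes "finite_simple_graph V E"
    and "\<And>v. v \<in> V \<Longrightarrow> 0 \<le> w v"
    and "k \<ge> max_degree V E + 1"
  shows "\<exists>C. is_coloring V E k C \<and> EQ1 2 w k C"
proof -
  define W where "W = (\<lambda>c l. sum w (color_class V c l))"
  define M where "M = (\<lambda>c. Min (W c ` {1..k}))"
  define N where "N = (\<lambda>c. card {l \<in> {1..k}. W c l = M c})"
  let ?P = "proper_on E k V"
  have fV: "finite V" using assms(1) by (simp add: finite_simple_graph_def)
  have k1: "{1..k} \<noteq> {}" using assms(3) by simp
  have M_le: "M c \<le> W c l" if "l \<in> {1..k}" for c l
    using that by (simp add: M_def)
  have M_in: "\<exists>l\<in>{1..k}. M c = W c l" for c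
    using Min_in[of "W c ` {1..k}"] k1 unfolding M_def by blast
  \<comment> \<open>There may be infinitely many functions \<open>c\<close>, as values outside
    \<open>V\<close> are free, but \<open>M\<close> takes only weights of subsets of
    \<open>V\<close> as values, so a maximum exists.\<close>
  have "M c \<in> sum w ` Pow V" for c
    using M_in[of c] by (auto simp: W_def color_class_def)
  then have fin: "finite (M ` Collect ?P)"
    by (intro finite_subset[of "M ` Collect ?P" "sum w ` Pow V"] image_subsetI finite_imageI)
       (simp_all add: fV)
  have "Collect ?P \<noteq> {}"
    using proper_on_extend[OF assms(1,3), of "{}"] by (auto simp: proper_on_def)
  then have "Max (M ` Collect ?P) \<in> M ` Collect ?P" using Max_in[OF fin] by blast
  then obtain c0 where c0: "?P c0" "M c0 = Max (M ` Collect ?P)" by fastforce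
  then have max: "M c \<le> M c0" if "?P c" for c
    using that fin by simp
  obtain c where c: "?P c" "M c = M c0"
    and min: "\<And>d. ?P d \<Longrightarrow> M d = M c0 \<Longrightarrow> N c \<le> N d"
    using c0(1) ex_has_least_nat[of "\<lambda>c. ?P c \<and> M c = M c0" c0 N] by auto
  obtain j where j: "j \<in> {1..k}" "M c = W c j" using M_in by blast
  have "EQ1 2 w k (color_class V c)"
  proof (rule ccontr)
    assume "\<not> ?thesis"
    then obtain i l where il: "i \<in> {1..k}" "l \<in> {1..k}" "color_class V c i \<noteq> {}"
      and heavy: "\<And>v. v \<in> color_class V c i \<Longrightarrow> 2 * W c l < sum w (color_class V c i - {v})"
      unfolding EQ1_def W_def not_le by (meson not_le)
    \<comment> \<open>The violation is against some class \<open>l\<close>; it persists against the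
      lightest class \<open>j\<close>.\<close>
    have "2 * W c j < sum w (color_class V c i - {v})" if "v \<in> color_class V c i" for v
      using heavy[OF that] M_le[OF il(2), of c] j(2) by linarith
    then have "\<exists>d. ?P d \<and> W c j < W d j \<and> (\<forall>l\<in>{1..k}. W c l \<le> W d l \<or> W c j < W d l)"
      unfolding W_def
      by (intro improve_coloring[OF assms(1,3) _ c(1) il(1) j(1) il(3)] assms(2))
    then obtain d where d: "?P d" "M c < W d j"
      and d_ge: "\<And>l. l \<in> {1..k} \<Longrightarrow> W c l \<le> W d l \<or> M c < W d l"
      using j(2) by auto
    have ge: "M c \<le> W d l" if "l \<in> {1..k}" for l
      using d_ge[OF that] M_le[OF that, of c] by linarith
    have "M c \<le> M d" using M_in[of d] ge by auto
    then have Md: "M d = M c" using max[OF d(1)] c(2) by linarith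
    \<comment> \<open>A class at the minimum under \<open>d\<close> cannot have risen above
      \<open>M c\<close>, so it was already at the minimum under \<open>c\<close>; class
      \<open>j\<close> has left the minimum, which makes the inclusion strict.\<close>
    have "{l \<in> {1..k}. W d l = M d} \<subset> {l \<in> {1..k}. W c l = M c}"
    proof
      show "{l \<in> {1..k}. W d l = M d} \<subseteq> {l \<in> {1..k}. W c l = M c}"
      proof clarify
        fix l assume "l \<in> {1..k}" "W d l = M d"
        then show "W c l = M c" using d_ge[of l] M_le[of l c] Md by linarith
      qed
      show "{l \<in> {1..k}. W d l = M d} \<noteq> {l \<in> {1..k}. W c l = M c}"
        using j d(2) Md by (metis (mono_tags, lifting) less_irrefl mem_Collect_eq)
    qed
    then have "N d < N c" unfolding N_def by (intro psubset_card_mono) auto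
    with min[OF d(1)] Md c(2) show False by simp
  qed
  with is_coloring_color_class[OF c(1)] show ?thesis by blast
qed

end
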